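(* There exist a group $H$ with a finite generating set $X$ and elements $g_1,g_2\in H$ of infinite order such that, with respect to the word metric of $X$, $g_1$ and $g_2$ are forward equivalent but not backward equivalent, i.e. $s(g_1^\infty,g_2^\infty)=0$ but $s(g_1^{-\infty},g_2^{-\infty})\neq 0$.
   Context: Let $G$ be a group with finite generating set $X$ and let $d$ be the word metric: $d(g,h)$ is the length of a shortest word over $X\cup X^{-1}$ representing $g^{-1}h$. For $g\in G$ of infinite order put $g^\infty=\{g^n:n\in\mathbb N\}$, $g^{-\infty}=(g^{-1})^\infty=\{g^{-n}:n\in\mathbb N\}$. For $\alpha>0$, $c\in\mathbb N$ the $(\alpha,c)$-cone around $g^\infty$ is $\alpha\cdot g^\infty+c=\{v\in G:\exists n\in\mathbb N,\ d(v,g^n)\le \alpha\, d(1,g^n)+c\}$. For $x=h^\infty$ write $x\subseteq \alpha\cdot g^\infty+c$ if every element of $x$ lies in this cone. For two such forward orbits $x,y$ define $s(x,y)=\inf\{\alpha>0:\exists c\in\mathbb N \text{ with } x\subseteq\alpha\cdot y+c \text{ and } y\subseteq \alpha\cdot x+c\}$. Elements $g,h$ are forward equivalent if $s(g^\infty,h^\infty)=0$ and backward equivalent if $s(g^{-\infty},h^{-\infty})=0$. *)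

theory Defs
  imports "HOL-Algebra.Generated_Groups" "HOL-Library.Extended_Real"
begin

definition word_len :: "('a, 'b) monoid_scheme \<Rightarrow> 'a set \<Rightarrow> 'a \<Rightarrow> nat" where
  "word_len G X g = (LEAST n. \<exists>ws. set ws \<subseteq> X \<union> m_inv G ` X \<and> length ws = n
                        \<and> foldr (\<otimes>\<^bsub>G\<^esub>) ws \<one>\<^bsub>G\<^esub> = g)"

definition word_dist :: "('a, 'b) monoid_scheme \<Rightarrow> 'a set \<Rightarrow> 'a \<Rightarrow> 'a \<Rightarrow> nat" where
  "word_dist G X g h = word_len G X (inv\<^bsub>G\<^esub> g \<otimes>\<^bsub>G\<^esub> h)"

definition fwd_orbit :: "('a, 'b) monoid_scheme \<Rightarrow> 'a \<Rightarrow> 'a set" where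
  "fwd_orbit G g = {g [^]\<^bsub>G\<^esub> (n::nat) | n. True}"

definition cone :: "('a, 'b) monoid_scheme \<Rightarrow> 'a set \<Rightarrow> real \<Rightarrow> 'a \<Rightarrow> nat \<Rightarrow> 'a set" where
  "cone G X \<alpha> g c = {v \<in> carrier G. \<exists>n::nat.
      real (word_dist G X v (g [^]\<^bsub>G\<^esub> n))
        \<le> \<alpha> * real (word_dist G X \<one>\<^bsub>G\<^esub> (g [^]\<^bsub>G\<^esub> n)) + real c}"

text \<open>s(g^\<infinity>, h^\<infinity>), as an extended real (infimum of the empty set is \<infinity>).\<close>
definition s_fwd :: "('a, 'b) monoid_scheme \<Rightarrow> 'a set \<Rightarrow> 'a \<Rightarrow> 'a \<Rightarrow> ereal" where
  "s_fwd G X g h = Inf {ereal \<alpha> | \<alpha>. \<alpha> > 0 \<and> (\<exists>c::nat.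
       fwd_orbit G g \<subseteq> cone G X \<alpha> h c \<and> fwd_orbit G h \<subseteq> cone G X \<alpha> g c)}"

definition forward_equiv :: "('a, 'b) monoid_scheme \<Rightarrow> 'a set \<Rightarrow> 'a \<Rightarrow> 'a \<Rightarrow> bool" where
  "forward_equiv G X g h \<longleftrightarrow> s_fwd G X g h = 0"

definition backward_equiv :: "('a, 'b) monoid_scheme \<Rightarrow> 'a set \<Rightarrow> 'a \<Rightarrow> 'a \<Rightarrow> bool" where
  "backward_equiv G X g h \<longleftrightarrow> s_fwd G X (inv\<^bsub>G\<^esub> g) (inv\<^bsub>G\<^esub> h) = 0"

definition infinite_order :: "('a, 'b) monoid_scheme \<Rightarrow> 'a \<Rightarrow> bool" where
  "infinite_order G g \<longleftrightarrow> (\<forall>n::nat. n > 0 \<longrightarrow> g [^]\<^bsub>G\<^esub> n \<noteq> \<one>\<^bsub>G\<^esub>)"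

end

theory Submission
  imports Defs "HOL-Library.Countable_Set" "HOL-Combinatorics.Transposition"
    "HOL-Real_Asymp.Real_Asymp"
begin

text \<open>
  Let \<open>t\<close> be the translation \<open>x \<mapsto> x + 1\<close> of the real line, let \<open>s\<close> double the negative
  numbers and fix the others, and let \<open>a\<close> be the transposition of \<open>0\<close> with an additional point
  \<open>\<infinity>\<close> fixed by \<open>t\<close> and \<open>s\<close>. In the group of permutations generated by these, \<open>t\<close> and its conjugate
  \<open>a t a\<inverse>\<close> are as desired. The distance between their \<open>n\<close>-th powers is, up to a constant,
  the length of \<open>t\<^sup>-\<^sup>n a t\<^sup>n\<close>, the transposition of \<open>-n\<close> and \<open>\<infinity>\<close>. A word that takes \<open>0\<close> to \<open>-n\<close>
  by binary expansion conjugates \<open>a\<close> to the same transposition, so the length is \<open>O(log n)\<close>,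
  while \<open>t\<^sup>n\<close> has length at least \<open>n\<close>. In the backward direction one gets permutations taking a
  positive number \<open>m\<close> to \<open>\<infinity>\<close>; since \<open>s\<close> is trivial on the positive half line, this
  takes at least \<open>m\<close> letters.
\<close>

section \<open>Words over a generating set and their products\<close>

lemma (in monoid) foldr_mult_closed: "set ws \<subseteq> carrier G \<Longrightarrow> foldr (\<otimes>) ws \<one> \<in> carrier G"
  by (induction ws) auto

lemma (in monoid) foldr_mult_append:
  assumes "set us \<subseteq> carrier G" "set vs \<subseteq> carrier G"
  shows "foldr (\<otimes>) (us @ vs) \<one> = foldr (\<otimes>) us \<one> \<otimes> foldr (\<otimes>) vs \<one>"
  using assms by (induction us) (auto simp: m_assoc foldr_mult_closed)

lemma (in group) foldr_mult_inv:
  assumes "set ws \<subseteq> carrier G"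
  shows "foldr (\<otimes>) (map (m_inv G) (rev ws)) \<one> = inv (foldr (\<otimes>) ws \<one>)"
  using assms
proof (induction ws)
  case (Cons w ws)
  have "set (map (m_inv G) (rev ws)) \<subseteq> carrier G"
    using Cons.prems by auto
  then show ?case
    using Cons foldr_mult_closed by (simp add: foldr_mult_append inv_mult_group del: foldr_append)
qed simp

lemma (in group) generate_imp_word:
  assumes "X \<subseteq> carrier G" "g \<in> generate G X"
  shows "\<exists>ws. set ws \<subseteq> X \<union> m_inv G ` X \<and> foldr (\<otimes>) ws \<one> = g"
  using assms(2)
proof induction
  case one
  show ?case by (rule exI[of _ "[]"]) simp
next
  case (incl h)
  then show ?case using assms(1) by (intro exI[of _ "[h]"]) auto
next
  case (inv h)
  then show ?case using assms(1) by (intro exI[of _ "[m_inv G h]"]) auto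
next
  case (eng g h)
  then obtain us vs where "set us \<subseteq> X \<union> m_inv G ` X" "foldr (\<otimes>) us \<one> = g"
    "set vs \<subseteq> X \<union> m_inv G ` X" "foldr (\<otimes>) vs \<one> = h"
    by blast
  moreover have "X \<union> m_inv G ` X \<subseteq> carrier G"
    using assms(1) by auto
  ultimately show ?case
    by (intro exI[of _ "us @ vs"]) (metis foldr_mult_append le_sup_iff set_append subset_trans)
qed

text \<open>Every element is the value of a word, and there are only countably many words. This is
  what makes a copy of the permutation group on \<open>nat\<close> possible.\<close>

lemma (in group) countable_generate:
  assumes "X \<subseteq> carrier G" "countable X"
  shows "countable (generate G X)"
proof -
  have "generate G X \<subseteq> (\<lambda>ws. foldr (\<otimes>) ws \<one>) ` lists (X \<union> m_inv G ` X)"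
    using generate_imp_word[OF assms(1)] by (fastforce simp: in_lists_conv_set)
  then show ?thesis
    using assms(2) by (meson countable_Un countable_image countable_lists countable_subset)
qed

lemma word_len_le:
  assumes "set ws \<subseteq> X \<union> m_inv G ` X" "foldr (\<otimes>\<^bsub>G\<^esub>) ws \<one>\<^bsub>G\<^esub> = g"
  shows "word_len G X g \<le> length ws"
  unfolding word_len_def using assms by (intro Least_le) blast

text \<open>The infimum is taken over positive numbers, hence is never negative, and it vanishes
  exactly when admissible \<alpha> occur below every positive bound.\<close>

lemma s_fwd_eq_0_iff:
  "s_fwd G X g h = 0 \<longleftrightarrow> (\<forall>e>0. \<exists>\<alpha> c. 0 < \<alpha> \<and> \<alpha> < e \<and>
     fwd_orbit G g \<subseteq> cone G X \<alpha> h c \<and> fwd_orbit G h \<subseteq> cone G X \<alpha> g c)"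
    (is "?l \<longleftrightarrow> ?r")
proof -
  let ?A = "{ereal \<alpha> | \<alpha>. \<alpha> > 0 \<and> (\<exists>c::nat.
       fwd_orbit G g \<subseteq> cone G X \<alpha> h c \<and> fwd_orbit G h \<subseteq> cone G X \<alpha> g c)}"
  have "0 \<le> Inf ?A"
    by (rule Inf_greatest) auto
  then have "s_fwd G X g h = 0 \<longleftrightarrow> Inf ?A \<le> 0"
    unfolding s_fwd_def by auto
  also have "\<dots> \<longleftrightarrow> (\<forall>e::real. e > 0 \<longrightarrow> Inf ?A < ereal e)"
  proof (intro iffI allI impI)
    assume *: "\<forall>e::real. e > 0 \<longrightarrow> Inf ?A < ereal e"
    show "Inf ?A \<le> 0"
    proof (rule ccontr)
      assume "\<not> Inf ?A \<le> 0"
      then obtain e where "0 < ereal e" "ereal e < Inf ?A"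
        using ereal_dense2[of 0 "Inf ?A"] by (auto simp: not_le)
      with * show False by (meson ereal_less(2) less_asym)
    qed
  qed (meson ereal_less(2) order.strict_trans1)
  also have "\<dots> \<longleftrightarrow> ?r"
    unfolding Inf_less_iff setcompr_eq_image by (intro all_cong1 imp_cong refl) auto
  finally show ?thesis .
qed

section \<open>Word length and word metric\<close>

locale finitely_generated_group = group +
  fixes X
  assumes gens_closed: "X \<subseteq> carrier G" and generate_gens: "generate G X = carrier G"
begin

abbreviation len :: "'a \<Rightarrow> nat" where "len \<equiv> word_len G X"

lemma letters_closed: "X \<union> m_inv G ` X \<subseteq> carrier G"
  using gens_closed by auto

lemma obtain_word:
  assumes "g \<in> carrier G"
  obtains ws where "set ws \<subseteq> X \<union> m_inv G ` X" "foldr (\<otimes>) ws \<one> = g" "length ws = len g"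
proof -
  have "\<exists>n ws. set ws \<subseteq> X \<union> m_inv G ` X \<and> length ws = n \<and> foldr (\<otimes>) ws \<one> = g"
    using generate_imp_word[OF gens_closed] assms generate_gens by blast
  from LeastI_ex[OF this] that show thesis
    unfolding word_len_def by blast
qed

lemma len_one [simp]: "len \<one> = 0"
  using word_len_le[of "[]"] by simp

lemma len_gen: "x \<in> X \<Longrightarrow> len x \<le> 1"
  using word_len_le[of "[x]" X G x] gens_closed by auto

lemma len_mult:
  assumes "g \<in> carrier G" "h \<in> carrier G"
  shows "len (g \<otimes> h) \<le> len g + len h"
proof -
  obtain us where us: "set us \<subseteq> X \<union> m_inv G ` X" "foldr (\<otimes>) us \<one> = g" "length us = len g"
    using obtain_word assms by blast
  obtain vs where vs: "set vs \<subseteq> X \<union> m_inv G ` X" "foldr (\<otimes>) vs \<one> = h" "length vs = len h"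
    using obtain_word assms by blast
  have "foldr (\<otimes>) (us @ vs) \<one> = g \<otimes> h"
    using us vs letters_closed by (metis foldr_mult_append subset_trans)
  then show ?thesis
    using word_len_le[of "us @ vs" X G "g \<otimes> h"] us vs by auto
qed

lemma len_inv_le:
  assumes "g \<in> carrier G"
  shows "len (inv g) \<le> len g"
proof -
  obtain us where us: "set us \<subseteq> X \<union> m_inv G ` X" "foldr (\<otimes>) us \<one> = g" "length us = len g"
    using obtain_word assms by blast
  have "set (map (m_inv G) (rev us)) \<subseteq> X \<union> m_inv G ` X"
    using us(1) gens_closed by (fastforce simp: subset_iff)
  then show ?thesis
    using word_len_le[of "map (m_inv G) (rev us)" X G "inv g"]
      foldr_mult_inv[of us] us letters_closed by auto
qed

lemma len_inv [simp]: "g \<in> carrier G \<Longrightarrow> len (inv g) = len g"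
  by (metis inv_closed inv_inv len_inv_le order_antisym)

lemma len_pow_gen: "x \<in> X \<Longrightarrow> len (x [^] (n::nat)) \<le> n"
proof (induction n)
  case (Suc n)
  have "len (x [^] n \<otimes> x) \<le> len (x [^] n) + len x"
    using Suc.prems gens_closed by (intro len_mult) auto
  then show ?case
    using Suc len_gen[of x] by simp
qed simp

lemma word_dist_one [simp]: "g \<in> carrier G \<Longrightarrow> word_dist G X \<one> g = len g"
  by (simp add: word_dist_def)

lemma word_dist_commute:
  assumes "g \<in> carrier G" "h \<in> carrier G"
  shows "word_dist G X g h = word_dist G X h g"
proof -
  have "inv (inv g \<otimes> h) = inv h \<otimes> g"
    using assms by (simp add: inv_mult_group)
  then show ?thesis
    unfolding word_dist_def using assms by (metis inv_closed len_inv m_closed)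
qed

end

lemma (in group) conj_nat_pow:
  assumes "a \<in> carrier G" "g \<in> carrier G"
  shows "(a \<otimes> g \<otimes> inv a) [^] (n::nat) = a \<otimes> g [^] n \<otimes> inv a"
proof (induction n)
  case (Suc n)
  have "a \<otimes> g [^] n \<otimes> inv a \<otimes> (a \<otimes> g \<otimes> inv a) = a \<otimes> g [^] n \<otimes> (inv a \<otimes> a) \<otimes> g \<otimes> inv a"
    using assms by (simp add: m_assoc del: l_inv r_inv Units_l_inv Units_r_inv)
  then show ?case
    using Suc assms by (simp add: m_assoc)
qed (use assms in simp)

section \<open>Permutation groups and their transport to the natural numbers\<close>

definition perm_group :: "('a \<Rightarrow> 'a) monoid" where
  "perm_group = \<lparr>carrier = {f. bij f}, mult = (\<circ>), one = id\<rparr>"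

lemma perm_group_simps [simp]:
  "carrier perm_group = {f. bij f}" "f \<otimes>\<^bsub>perm_group\<^esub> g = f \<circ> g" "\<one>\<^bsub>perm_group\<^esub> = id"
  by (simp_all add: perm_group_def)

lemma group_perm_group: "group perm_group"
proof (rule groupI)
  fix f :: "'a \<Rightarrow> 'a"
  assume "f \<in> carrier perm_group"
  then show "\<exists>g\<in>carrier perm_group. g \<otimes>\<^bsub>perm_group\<^esub> f = \<one>\<^bsub>perm_group\<^esub>"
    by (intro bexI[of _ "inv_into UNIV f"]) (auto simp: bij_imp_bij_inv bij_is_inj)
qed (auto simp: bij_comp comp_assoc)

text \<open>The multiplication is carried over along an injection \<open>f\<close> of the carrier
  into \<open>nat\<close>, which \<open>g\<close> decodes.\<close>

lemma countable_group_iso_nat: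
  fixes G (structure)
  assumes "group G" "countable (carrier G)"
  obtains H :: "nat monoid" and \<phi> where "group H" "\<phi> \<in> iso G H"
proof -
  interpret group G by fact
  define f where "f = to_nat_on (carrier G)"
  define g where "g = inv_into (carrier G) f"
  have inj: "inj_on f (carrier G)"
    using assms(2) unfolding f_def by (rule inj_on_to_nat_on)
  have gf: "g (f x) = x" if "x \<in> carrier G" for x
    using that inj by (simp add: g_def)
  define H where "H = \<lparr>carrier = f ` carrier G, mult = \<lambda>a b. f (g a \<otimes> g b), one = f \<one>\<rparr>"
  have "monoid H"
    by unfold_locales (auto simp: H_def gf m_assoc)
  moreover have iso: "f \<in> iso G H"
    using inj by (auto simp: iso_def hom_def H_def gf bij_betw_def)
  ultimately have "group H"
    using iso_imp_group is_isoI by blast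
  with iso show thesis by (rule that[rotated])
qed

text \<open>The theorem asks for a group on \<open>nat\<close>, while the example consists of
  permutations. The copy \<open>H\<close> retains the action on points through the embedding
  \<open>\<phi>\<close>.\<close>

lemma nat_group_of_permutations:
  fixes F :: "('a \<Rightarrow> 'a) set"
  assumes "countable F" "\<And>f. f \<in> F \<Longrightarrow> bij f"
  obtains H :: "nat monoid" and \<phi>
  where "group H" "\<phi> \<in> hom H perm_group" "inj_on \<phi> (carrier H)"
    "F \<subseteq> \<phi> ` carrier H" "generate H (inv_into (carrier H) \<phi> ` F) = carrier H"
proof -
  interpret S: group "perm_group :: ('a \<Rightarrow> 'a) monoid" by (rule group_perm_group)
  have F: "F \<subseteq> carrier perm_group" using assms by auto
  define P where "P = perm_group\<lparr>carrier := generate perm_group F\<rparr>"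
  have sub: "subgroup (generate perm_group F) perm_group"
    using F by (rule S.generate_is_subgroup)
  interpret P: group P
    unfolding P_def using sub by (rule S.subgroup_imp_group)
  have FP: "F \<subseteq> carrier P"
    by (auto simp: P_def intro: generate.incl)
  have gen: "generate P F = carrier P"
    using S.generate_consistent[OF _ sub, of F] by (auto simp: P_def intro: generate.incl)
  obtain H :: "nat monoid" and \<psi> where H: "group H" "\<psi> \<in> iso P H"
    using countable_group_iso_nat[OF P.is_group] S.countable_generate[OF F assms(1)]
    by (auto simp: P_def)
  interpret H: group H by (rule H)
  interpret group_hom P H \<psi>
    using H by (unfold_locales) (auto simp: iso_def)
  define \<phi> where "\<phi> = inv_into (carrier P) \<psi>"
  have bij\<psi>: "bij_betw \<psi> (carrier P) (carrier H)"
    using H by (simp add: iso_def)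
  have iso: "\<phi> \<in> iso H P"
    unfolding \<phi>_def using H by (simp add: P.iso_set_sym)
  then have bij\<phi>: "bij_betw \<phi> (carrier H) (carrier P)"
    by (simp add: iso_def)
  \<comment> \<open>Since \<open>\<phi>\<close> inverts \<open>\<psi>\<close>, the preimages of
    \<open>F\<close> under \<open>\<phi>\<close> are its images under \<open>\<psi>\<close>, and a
    homomorphism commutes with \<open>generate\<close>.\<close>
  have "inv_into (carrier H) \<phi> f = \<psi> f" if "f \<in> F" for f
    using bij\<psi> that FP bij_betw_apply[OF bij\<psi>]
    by (intro inv_into_f_eq[OF bij_betw_imp_inj_on[OF bij\<phi>]])
       (auto simp: \<phi>_def bij_betw_inv_into_left)
  then have "generate H (inv_into (carrier H) \<phi> ` F) = \<psi> ` generate P F"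
    using generate_img[OF FP] by (metis (no_types, lifting) image_cong)
  also have "\<dots> = carrier H"
    using gen bij\<psi> by (simp add: bij_betw_imp_surj_on)
  finally have 1: "generate H (inv_into (carrier H) \<phi> ` F) = carrier H" .
  have "carrier P \<subseteq> carrier perm_group"
    using subgroup.subset[OF sub] by (simp add: P_def)
  then have 2: "\<phi> \<in> hom H perm_group"
    using iso by (auto simp: iso_def hom_def P_def)
  show thesis
    using that[OF H(1) 2 _ _ 1] bij\<phi> FP by (simp add: bij_betw_def)
qed

section \<open>The three generating permutations, with \<open>None\<close> as the point
  \<infinity>\<close>

definition translation :: "real option \<Rightarrow> real option" where
  "translation = map_option (\<lambda>x. x + 1)"

definition half_doubling :: "real option \<Rightarrow> real option" where
  "half_doubling = map_option (\<lambda>x. if x < 0 then 2 * x else x)"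

definition swap_origin :: "real option \<Rightarrow> real option" where
  "swap_origin = Transposition.transpose (Some 0) None"

lemma bij_translation: "bij translation"
proof (rule o_bij)
  show "map_option (\<lambda>x. x - 1) \<circ> translation = id" "translation \<circ> map_option (\<lambda>x. x - 1) = id"
    by (auto simp: translation_def fun_eq_iff option.map_comp comp_def option.map_ident)
qed

lemma bij_half_doubling: "bij half_doubling"
proof (rule o_bij)
  let ?h = "map_option (\<lambda>x::real. if x < 0 then x / 2 else x)"
  have "?h (half_doubling x) = x" "half_doubling (?h x) = x" for x
    by (cases x; simp add: half_doubling_def)+
  then show "?h \<circ> half_doubling = id" "half_doubling \<circ> ?h = id"
    by (auto simp: fun_eq_iff)
qed

lemma bij_swap_origin: "bij swap_origin"
  by (simp add: swap_origin_def)

text \<open>The group enters only through a faithful action with prescribed generators, so the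
  arguments apply directly to the copy on \<open>nat\<close>. Faithfulness turns equality of
  permutations into equality in \<open>G\<close>.\<close>

locale shortcut_group = finitely_generated_group G "{t, s, a}" for G (structure) and t s a +
  fixes act :: "'a \<Rightarrow> real option \<Rightarrow> real option"
  assumes act_hom: "act \<in> hom G perm_group"
    and faithful: "inj_on act (carrier G)"
    and act_t: "act t = translation"
    and act_s: "act s = half_doubling"
    and act_a: "act a = swap_origin"
begin

sublocale act: group_hom G "perm_group :: (real option \<Rightarrow> real option) monoid" act
  using act_hom group_perm_group by (unfold_locales) (auto simp: group_def group_axioms_def monoid_def)

text \<open>As a rewrite rule it would replace \<open>act (inv t)\<close> by an inverse in
  \<open>perm_group\<close>, out of reach of the pointwise rules for inverses below.\<close>

declare act.hom_inv [simp del]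

section \<open>Action on points and displacement\<close>

lemma gen_closed [simp]: "t \<in> carrier G" "s \<in> carrier G" "a \<in> carrier G"
  using gens_closed by auto

lemma act_mult: "\<lbrakk>g \<in> carrier G; h \<in> carrier G\<rbrakk> \<Longrightarrow> act (g \<otimes> h) p = act g (act h p)"
  using act.hom_mult by simp

lemma act_one: "act \<one> p = p"
  using act.hom_one by simp

lemma act_inv_eqI: "\<lbrakk>g \<in> carrier G; act g q = p\<rbrakk> \<Longrightarrow> act (inv g) p = q"
  using act_mult[of "inv g" g q] act_one by simp

lemma act_inv_t [simp]: "act (inv t) (Some x) = Some (x - 1)" "act (inv t) None = None"
  by (auto intro!: act_inv_eqI simp: act_t translation_def)

lemma act_inv_a [simp]: "act (inv a) p = swap_origin p"
  by (auto intro!: act_inv_eqI simp: act_a swap_origin_def)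

lemma swap_origin_simps [simp]:
  "swap_origin None = Some 0" "swap_origin (Some 0) = None"
  "x \<noteq> 0 \<Longrightarrow> swap_origin (Some x) = Some x"
  by (auto simp: swap_origin_def)

lemma act_t_pow: "act (t [^] (n::nat)) (Some x) = Some (x + n)"
  "act (t [^] n) None = None"
proof (induction n arbitrary: x)
  case (Suc n)
  { case 1 show ?case using Suc by (simp add: act_mult act_t translation_def) }
  { case 2 show ?case using Suc by (simp add: act_mult act_t translation_def) }
qed (simp_all add: act_one)

lemma act_inv_t_pow: "act (inv t [^] (n::nat)) (Some x) = Some (x - n)"
  "act (inv t [^] n) None = None"
  by (auto intro!: act_inv_eqI simp: act_t_pow nat_pow_inv)

text \<open>Far out on the positive half line the doubling map is trivial, so a short word only
  translates slowly there and never reaches the point \<open>None\<close> at infinity.\<close>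

lemma act_displacement:
  fixes x :: real
  assumes "g \<in> carrier G" "len g < x"
  obtains y where "act g (Some x) = Some y" "\<bar>y - x\<bar> \<le> len g"
proof -
  have step: "\<exists>z. act u (Some y) = Some z \<and> \<bar>z - y\<bar> \<le> 1"
    if "u \<in> {t, s, a} \<union> m_inv G ` {t, s, a}" "y > 0" for u y
  proof -
    have "act (inv s) (Some y) = Some y"
      using \<open>y > 0\<close> by (intro act_inv_eqI) (auto simp: act_s half_doubling_def)
    then show ?thesis
      using that by (auto simp: act_t translation_def act_s half_doubling_def act_a)
  qed
  have word: "\<exists>y. act (foldr (\<otimes>) ws \<one>) (Some x) = Some y \<and> \<bar>y - x\<bar> \<le> length ws"
    if "set ws \<subseteq> {t, s, a} \<union> m_inv G ` {t, s, a}" "length ws < x" for ws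
    using that
  proof (induction ws)
    case (Cons u ws)
    then obtain y where y: "act (foldr (\<otimes>) ws \<one>) (Some x) = Some y" "\<bar>y - x\<bar> \<le> length ws"
      by force
    \<comment> \<open>Here \<open>y\<close> is at least \<open>x - length ws\<close>, which exceeds
      1 because the word with \<open>u\<close> in front is still shorter than \<open>x\<close>; so
      the point has stayed positive.\<close>
    moreover obtain z where "act u (Some y) = Some z" "\<bar>z - y\<bar> \<le> 1"
      using step[of u y] Cons.prems y by force
    moreover have "act (u \<otimes> foldr (\<otimes>) ws \<one>) (Some x) = act u (act (foldr (\<otimes>) ws \<one>) (Some x))"
      using Cons.prems letters_closed by (intro act_mult foldr_mult_closed) auto
    ultimately show ?case by auto
  qed (simp add: act_one)
  obtain ws where "set ws \<subseteq> {t, s, a} \<union> m_inv G ` {t, s, a}" "foldr (\<otimes>) ws \<one> = g"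
    "length ws = len g"
    using obtain_word assms(1) by blast
  with word[of ws] assms(2) that show thesis by auto
qed

text \<open>A point beyond both \<open>K\<close> and \<open>len g\<close> is moved by exactly
  \<open>d\<close>, but also by at most \<open>len g\<close>.\<close>

lemma len_ge_displacement:
  assumes "g \<in> carrier G" "\<And>x. x > K \<Longrightarrow> act g (Some x) = Some (x + d)"
  shows "\<bar>d\<bar> \<le> len g"
proof -
  define x where "x = max K (len g) + 1"
  have x: "x > K" "x > len g" by (auto simp: x_def)
  show ?thesis
    using act_displacement[OF assms(1) x(2)] assms(2)[OF x(1)] by force
qed

text \<open>Binary expansion of \<open>n\<close>: doubling the point \<open>-n\<close> is a single letter.\<close>

lemma ex_short_to_minus:
  "n < 2 ^ k \<Longrightarrow> \<exists>v \<in> carrier G. act v (Some 0) = Some (- real n) \<and> act v None = None \<and> len v \<le> 2 * k"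
proof (induction k arbitrary: n)
  case 0
  then show ?case by (intro bexI[of _ \<one>]) (auto simp: act_one)
next
  case (Suc k)
  obtain v where v: "v \<in> carrier G" "act v (Some 0) = Some (- real (n div 2))"
    "act v None = None" "len v \<le> 2 * k"
    using Suc.IH[of "n div 2"] less_mult_imp_div_less[of n "2 ^ k" 2] Suc.prems
    by (metis mult.commute power_Suc)
  have sv: "act (s \<otimes> v) (Some 0) = Some (- real (2 * (n div 2)))" "act (s \<otimes> v) None = None"
    using v by (auto simp: act_mult act_s half_doubling_def)
  have len: "len (s \<otimes> v) \<le> 2 * k + 1"
    using len_mult[of s v] len_gen[of s] v by simp
  show ?case
  \<comment> \<open>The last binary digit decides whether a translation must follow the doubling;
    each digit costs at most two letters.\<close>
  proof (cases "even n")
    case True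
    then show ?thesis using sv len v(1) by (intro bexI[of _ "s \<otimes> v"]) auto
  next
    case False
    have "act (inv t \<otimes> (s \<otimes> v)) (Some 0) = Some (- real (2 * (n div 2)) - 1)"
      "act (inv t \<otimes> (s \<otimes> v)) None = None"
      using sv v(1) by (simp_all add: act_mult[of "inv t"])
    moreover have "- real (2 * (n div 2)) - 1 = - real n"
      using odd_two_times_div_two_succ[OF False] by linarith
    moreover have "len (inv t \<otimes> (s \<otimes> v)) \<le> 2 * Suc k"
      using len_mult[of "inv t" "s \<otimes> v"] len_gen[of t] v len by simp
    ultimately show ?thesis using v(1) by (intro bexI[of _ "inv t \<otimes> (s \<otimes> v)"]) auto
  qed
qed

section \<open>Forward equivalence\<close>

lemma act_conj_a:
  assumes "g \<in> carrier G" "act g None = None"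
  shows "act (g \<otimes> a \<otimes> inv g) = Transposition.transpose (act g (Some 0)) None"
proof
  fix p
  have inj: "inj (act g)"
    using act.hom_closed[OF assms(1)] by (simp add: bij_is_inj)
  define q where "q = act (inv g) p"
  have p: "p = act g q"
    using act_mult[of g "inv g" p] assms act_one by (simp add: q_def)
  have "act (g \<otimes> a \<otimes> inv g) p = act g (swap_origin q)"
    using assms by (simp add: act_mult act_a q_def)
  also have "\<dots> = Transposition.transpose (act g (Some 0)) (act g None) (act g q)"
    unfolding swap_origin_def Transposition.transpose_def by (auto dest: injD[OF inj])
  finally show "act (g \<otimes> a \<otimes> inv g) p = Transposition.transpose (act g (Some 0)) None p"
    using p assms by simp
qed

text \<open>Conjugating \<open>a\<close> by the short \<open>v\<close> and by
  \<open>inv t [^] n\<close> gives the same transposition of \<open>- n\<close> and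
  \<open>None\<close>, hence the same element by faithfulness.\<close>

lemma len_forward_le:
  fixes n :: nat
  assumes "n < 2 ^ k"
  shows "len (inv (t [^] n) \<otimes> (a \<otimes> t [^] n \<otimes> inv a)) \<le> 4 * k + 2"
proof -
  obtain v where v: "v \<in> carrier G" "act v (Some 0) = Some (- real n)"
    "act v None = None" "len v \<le> 2 * k"
    using ex_short_to_minus[OF assms] by blast
  let ?u = "inv t [^] n"
  have "act (v \<otimes> a \<otimes> inv v) = act (?u \<otimes> a \<otimes> inv ?u)"
    using v by (simp add: act_conj_a act_inv_t_pow del: act.hom_mult)
  then have eq: "v \<otimes> a \<otimes> inv v = ?u \<otimes> a \<otimes> inv ?u"
    by (rule inj_onD[OF faithful]) (use v(1) in simp_all)
  have "inv (t [^] n) \<otimes> (a \<otimes> t [^] n \<otimes> inv a) = v \<otimes> a \<otimes> inv v \<otimes> inv a"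
    unfolding eq by (simp add: nat_pow_inv m_assoc)
  moreover have "len (v \<otimes> a \<otimes> inv v \<otimes> inv a) \<le> len v + len a + len v + len a"
    using v(1) len_mult[of "v \<otimes> a \<otimes> inv v" "inv a"] len_mult[of "v \<otimes> a" "inv v"] len_mult[of v a]
    by simp
  ultimately show ?thesis
    using v(4) len_gen[of a] by simp
qed

lemma len_t_pow_ge: "n \<le> len (t [^] n)"
  using len_ge_displacement[of "t [^] n" 0 "real n"] by (simp add: act_t_pow)

lemma len_conj_t_pow_ge: "n \<le> len (a \<otimes> t [^] n \<otimes> inv a)"
  using len_ge_displacement[of "a \<otimes> t [^] n \<otimes> inv a" 0 "real n"]
  by (simp add: act_mult act_a act_t_pow)

lemma infinite_order_t: "infinite_order G t"
  unfolding infinite_order_def using len_t_pow_ge by (metis len_one leD)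

lemma infinite_order_conj_t: "infinite_order G (a \<otimes> t \<otimes> inv a)"
  unfolding infinite_order_def conj_nat_pow[OF gen_closed(3,1)]
  using len_conj_t_pow_ge by (metis len_one leD)

text \<open>The bound \<open>4 * k + 2\<close> is logarithmic in \<open>n\<close>, so it lies below
  any linear function up to a constant.\<close>

lemma forward_bound:
  fixes \<alpha> :: real
  assumes "\<alpha> > 0"
  obtains c :: nat
  where "\<And>n. len (inv (t [^] n) \<otimes> (a \<otimes> t [^] n \<otimes> inv a)) \<le> \<alpha> * real n + c"
proof -
  have "eventually (\<lambda>k::nat. 4 * real k + 2 \<le> \<alpha> / 2 * (2 ^ k - 1)) sequentially"
    using assms by real_asymp
  then obtain K where K: "\<And>k. k \<ge> K \<Longrightarrow> 4 * real k + 2 \<le> \<alpha> / 2 * (2 ^ k - 1)"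
    by (auto simp: eventually_sequentially)
  \<comment> \<open>The constant \<open>4 * K + 2\<close> absorbs the finitely many cases with
    \<open>k < K\<close>.\<close>
  have "len (inv (t [^] n) \<otimes> (a \<otimes> t [^] n \<otimes> inv a)) \<le> \<alpha> * real n + real (4 * K + 2)" for n
  proof -
    define k where "k = (LEAST k. n < 2 ^ k)"
    have k: "n < 2 ^ k"
      unfolding k_def by (rule LeastI_ex) (use less_exp in blast)
    \<comment> \<open>Minimality of \<open>k\<close> gives \<open>2 ^ k \<le> 2 * n\<close> for
      positive \<open>k\<close>; the extra 1 covers \<open>n = 0\<close>, where
      \<open>k = 0\<close>.\<close>
    have "2 ^ k \<le> 2 * n + (1::nat)"
    proof (cases k)
      case (Suc j)
      then have "\<not> n < 2 ^ j" using not_less_Least[of j "\<lambda>k. n < 2 ^ k"] k_def by auto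
      then show ?thesis by (simp add: Suc)
    qed simp
    then have "real (2 ^ k) \<le> real (2 * n + 1)"
      by (simp only: of_nat_le_iff)
    then have "(2 ^ k - 1) / 2 \<le> real n"
      by simp
    then have "\<alpha> * ((2 ^ k - 1) / 2) \<le> \<alpha> * real n"
      using assms by (intro mult_left_mono) auto
    moreover have "4 * real k + 2 \<le> \<alpha> * ((2 ^ k - 1) / 2) + real (4 * K + 2)"
    proof (cases "k \<ge> K")
      case True
      then show ?thesis using K[of k] by simp
    next
      case False
      have "0 \<le> \<alpha> * ((2 ^ k - 1) / 2)" using assms by simp
      with False show ?thesis by simp
    qed
    ultimately show ?thesis
      using len_forward_le[OF k] by linarith
  qed
  then show thesis by (rule that)
qed

lemma forward_equiv_conj: "forward_equiv G {t, s, a} t (a \<otimes> t \<otimes> inv a)"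
proof -
  let ?g = "a \<otimes> t \<otimes> inv a"
  have "\<exists>\<alpha> c. 0 < \<alpha> \<and> \<alpha> < e \<and> fwd_orbit G t \<subseteq> cone G {t, s, a} \<alpha> ?g c \<and>
      fwd_orbit G ?g \<subseteq> cone G {t, s, a} \<alpha> t c" if "e > 0" for e :: real
  proof -
    define \<alpha> where "\<alpha> = e / 2"
    have \<alpha>: "0 < \<alpha>" "\<alpha> < e" using that by (auto simp: \<alpha>_def)
    obtain c :: nat where c:
      "\<And>n. word_dist G {t, s, a} (t [^] n) (a \<otimes> t [^] n \<otimes> inv a) \<le> \<alpha> * real n + c"
      using forward_bound[OF \<alpha>(1)] unfolding word_dist_def by metis
    \<comment> \<open>Powers with equal exponents are compared. Their lengths are at least
      \<open>n\<close>, so the error \<open>\<alpha> * n\<close> fits into either cone.\<close>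
    have "\<alpha> * real n \<le> \<alpha> * real (len (t [^] n))" "\<alpha> * real n \<le> \<alpha> * real (len (?g [^] n))" for n
      using \<alpha>(1) len_t_pow_ge len_conj_t_pow_ge by (simp_all add: conj_nat_pow)
    then have "word_dist G {t, s, a} (t [^] n) (?g [^] n)
         \<le> \<alpha> * real (word_dist G {t, s, a} \<one> (?g [^] n)) + c"
      "word_dist G {t, s, a} (?g [^] n) (t [^] n)
         \<le> \<alpha> * real (word_dist G {t, s, a} \<one> (t [^] n)) + c" for n :: nat
      using c[of n] word_dist_commute[of "?g [^] n" "t [^] n"]
      by (force simp: conj_nat_pow intro: order_trans)+
    then have "fwd_orbit G t \<subseteq> cone G {t, s, a} \<alpha> ?g c" "fwd_orbit G ?g \<subseteq> cone G {t, s, a} \<alpha> t c"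
      unfolding fwd_orbit_def cone_def by auto
    with \<alpha> show ?thesis by blast
  qed
  then show ?thesis
    unfolding forward_equiv_def s_fwd_eq_0_iff by blast
qed

section \<open>Failure of backward equivalence\<close>

text \<open>The length of \<open>u\<close> is the distance from \<open>inv t [^] n\<close> to the
  \<open>m\<close>-th power of the inverse of the conjugate.\<close>

lemma backward_lower_bound:
  fixes m n :: nat
  defines "u \<equiv> t [^] n \<otimes> (a \<otimes> inv t [^] m \<otimes> inv a)"
  shows "m \<le> len u" "n \<le> m + len u"
proof -
  have u: "u \<in> carrier G" by (simp add: u_def)
  show "m \<le> len u"
  proof (rule ccontr)
    assume "\<not> m \<le> len u"
    then have "len u < real m" by simp
    then obtain y where "act u (Some (real m)) = Some y"
      using act_displacement[OF u] by blast
    \<comment> \<open>Positivity ensures that \<open>inv a\<close> fixes \<open>m\<close>; then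
      \<open>m\<close> goes to 0, to \<open>None\<close> under \<open>a\<close>, and stays
      there.\<close>
    moreover have "m > 0" using \<open>\<not> m \<le> len u\<close> by simp
    then have "act u (Some (real m)) = None"
      by (simp add: u_def act_mult act_a act_inv_t_pow act_t_pow)
    ultimately show False by simp
  qed
  \<comment> \<open>Both \<open>x\<close> and \<open>x - m\<close> are positive, so neither
    \<open>inv a\<close> nor \<open>a\<close> moves the point.\<close>
  have translates: "act u (Some x) = Some (x + (real n - real m))" if "x > real m" for x
    using that by (simp add: u_def act_mult act_a act_inv_t_pow act_t_pow)
  have "\<bar>real n - real m\<bar> \<le> len u"
    using u translates by (rule len_ge_displacement)
  then show "n \<le> m + len u"
    by linarith
qed

lemma not_backward_equiv_conj: "\<not> backward_equiv G {t, s, a} t (a \<otimes> t \<otimes> inv a)"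
proof
  let ?g = "inv (a \<otimes> t \<otimes> inv a)"
  have g: "?g = a \<otimes> inv t \<otimes> inv a"
    by (simp add: inv_mult_group m_assoc)
  assume "backward_equiv G {t, s, a} t (a \<otimes> t \<otimes> inv a)"
  then obtain \<alpha> :: real and c where \<alpha>: "0 < \<alpha>" "\<alpha> < 1 / 2"
    and sub: "fwd_orbit G (inv t) \<subseteq> cone G {t, s, a} \<alpha> ?g c"
    unfolding backward_equiv_def s_fwd_eq_0_iff by (metis zero_less_divide_1_iff zero_less_numeral)
  \<comment> \<open>A cone point \<open>m\<close> near \<open>inv t [^] n\<close> will satisfy
    \<open>2 * L \<le> m + 2 + 2 * c\<close> and \<open>m \<le> L\<close>. Then \<open>m\<close> and
    \<open>L\<close> are at most \<open>2 * c + 2\<close>, so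
    \<open>n \<le> m + L \<le> 4 * c + 4\<close>, which this choice just exceeds.\<close>
  define n where "n = 4 * c + 5"
  have "inv t [^] n \<in> cone G {t, s, a} \<alpha> ?g c"
    using sub by (auto simp: fwd_orbit_def)
  then obtain m :: nat where m: "word_dist G {t, s, a} (inv t [^] n) (?g [^] m)
      \<le> \<alpha> * word_dist G {t, s, a} \<one> (?g [^] m) + c"
    by (auto simp: cone_def)
  define L where "L = len (t [^] n \<otimes> (a \<otimes> inv t [^] m \<otimes> inv a))"
  have "len (?g [^] m) \<le> m + 2"
    using len_mult[of "a \<otimes> inv t [^] m" "inv a"] len_mult[of a "inv t [^] m"] len_gen[of a]
      len_pow_gen[of t m]
    by (simp add: g conj_nat_pow nat_pow_inv)
  then have "\<alpha> * len (?g [^] m) \<le> 1 / 2 * (real m + 2)"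
    using \<alpha> by (intro mult_mono) auto
  moreover have "L \<le> \<alpha> * len (?g [^] m) + c"
    using m by (simp add: L_def word_dist_def g conj_nat_pow nat_pow_inv)
  ultimately have "real L \<le> 1 / 2 * (real m + 2) + real c"
    by (meson add_right_mono order_trans)
  then have "2 * real L \<le> real m + 2 + 2 * real c"
    by (simp add: field_simps)
  then have "2 * L \<le> m + 2 + 2 * c"
    by linarith
  moreover have "m \<le> L" "n \<le> m + L"
    unfolding L_def by (rule backward_lower_bound)+
  ultimately show False
    unfolding n_def by linarith
qed

end

theorem theorem1p1:
  "\<exists>(H :: nat monoid) X g1 g2.
     group H \<and> finite X \<and> X \<subseteq> carrier H \<and> generate H X = carrier H \<and>
     g1 \<in> carrier H \<and> g2 \<in> carrier H \<and>
     infinite_order H g1 \<and> infinite_order H g2 \<and>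
     forward_equiv H X g1 g2 \<and> \<not> backward_equiv H X g1 g2"
proof -
  let ?F = "{translation, half_doubling, swap_origin}"
  have "countable ?F" "\<And>f. f \<in> ?F \<Longrightarrow> bij f"
    using bij_translation bij_half_doubling bij_swap_origin by auto
  then obtain H :: "nat monoid" and \<phi> where H: "group H" "\<phi> \<in> hom H perm_group"
    "inj_on \<phi> (carrier H)" "?F \<subseteq> \<phi> ` carrier H"
    "generate H (inv_into (carrier H) \<phi> ` ?F) = carrier H"
    by (rule nat_group_of_permutations)
  define t s a where tsa: "t = inv_into (carrier H) \<phi> translation"
    "s = inv_into (carrier H) \<phi> half_doubling" "a = inv_into (carrier H) \<phi> swap_origin"
  interpret H: group H by (rule H)
  interpret shortcut_group H t s a \<phi>
    using H by unfold_locales (auto simp: tsa f_inv_into_f inv_into_into)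
  show ?thesis
    using H.group_axioms gens_closed generate_gens infinite_order_t infinite_order_conj_t
      forward_equiv_conj not_backward_equiv_conj
    by (intro exI[of _ H] exI[of _ "{t, s, a}"] exI[of _ t] exI[of _ "a \<otimes>\<^bsub>H\<^esub> t \<otimes>\<^bsub>H\<^esub> inv\<^bsub>H\<^esub> a"]) auto
qed

end
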